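(* Let $\mathcal A_1=(A_1,\cdot,[,]_1,\alpha_1)$ and $\mathcal A_2=(A_2,\bullet,[,]_2,\alpha_2)$ be Hom-Leibniz Poisson algebras and let $\lambda_1^l,\lambda_1^r,\rho_1^l,\rho_1^r:A_1\to gl(A_2)$ and $\lambda_2^l,\lambda_2^r,\rho_2^l,\rho_2^r:A_2\to gl(A_1)$ be linear maps such that $((A_1,\lambda_2^l,\lambda_2^r,\rho_2^l,\rho_2^r,\alpha_1),(A_2,\lambda_1^l,\lambda_1^r,\rho_1^l,\rho_1^r,\alpha_2))$ is a matched pair of Hom-Leibniz Poisson algebras. Then $(A_1\oplus A_2,\ast,\{,\},\alpha_1\oplus\alpha_2)$ is a Hom-Leibniz Poisson algebra, where for $x,y\in A_1$ and $u,v\in A_2$ $$(x+u)\ast(y+v)=(x\cdot y+\lambda_2^l(u)y+\lambda_2^r(v)x)+(u\bullet v+\lambda_1^l(x)v+\lambda_1^r(y)u),$$ $$\{x+u,y+v\}=([x,y]_1+\rho_2^l(u)y+\rho_2^r(v)x)+([u,v]_2+\rho_1^l(x)v+\rho_1^r(y)u),$$ $$(\alpha_1\oplus\alpha_2)(x+u)=\alpha_1(x)+\alpha_2(u).$$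
   Context: All vector spaces are over a field $\mathbb K$ of characteristic $0$; $gl(V)$ is the space of linear endomorphisms of $V$, and juxtaposition of operators is composition. A Hom-associative algebra $(A,\cdot,\alpha)$ is a vector space $A$ with a bilinear product and a linear map $\alpha:A\to A$ such that $\alpha(x\cdot y)=\alpha(x)\cdot\alpha(y)$ and $(x\cdot y)\cdot\alpha(z)=\alpha(x)\cdot(y\cdot z)$. A (right) Hom-Leibniz algebra $(A,[,],\alpha)$ is a vector space with a bilinear bracket and a linear map $\alpha$ such that $\alpha([x,y])=[\alpha(x),\alpha(y)]$ and $[[x,y],\alpha(z)]=[\alpha(x),[y,z]]+[[x,z],\alpha(y)]$. A Hom-Leibniz Poisson algebra $(A,\cdot,[,],\alpha)$ is such that $(A,\cdot,\alpha)$ is Hom-associative, $(A,[,],\alpha)$ is Hom-Leibniz, and $[x\cdot y,\alpha(z)]=\alpha(x)\cdot[y,z]+[x,z]\cdot\alpha(y)$ for all $x,y,z\in A$. A representation of a Hom-associative algebra $(A,\cdot,\alpha)$ is $(V,\lambda^l,\lambda^r,\phi)$ with $V$ a vector space, $\phi\in gl(V)$, and $\lambda^l,\lambda^r:A\to gl(V)$ linear such that for all $x,y\in A$: $\phi\lambda^l(x)=\lambda^l(\alpha(x))\phi$; $\phi\lambda^r(x)=\lambda^r(\alpha(x))\phi$; $\lambda^l(x\cdot y)\phi=\lambda^l(\alpha(x))\lambda^l(y)$; $\lambda^r(x\cdot y)\phi=\lambda^r(\alpha(y))\lambda^r(x)$; $\lambda^l(\alpha(x))\lambda^r(y)=\lambda^r(\alpha(y))\lambda^l(x)$.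 A representation of a Hom-Leibniz algebra $(A,[,],\alpha)$ is $(V,\rho^l,\rho^r,\phi)$ with $\phi\in gl(V)$ and $\rho^l,\rho^r:A\to gl(V)$ linear such that for all $x,y\in A$: $\rho^l(\alpha(x))\phi=\phi\rho^l(x)$; $\rho^r(\alpha(x))\phi=\phi\rho^r(x)$; $\rho^l([x,y])\phi=\rho^l(\alpha(x))\rho^l(y)+\rho^r(\alpha(y))\rho^l(x)$; $\rho^r(\alpha(y))\rho^l(x)=\rho^l(\alpha(x))\rho^r(y)+\rho^l([x,y])\phi$; $\rho^r(\alpha(y))\rho^r(x)=\rho^r([x,y])\phi+\rho^r(\alpha(x))\rho^r(y)$. A representation of a Hom-Leibniz Poisson algebra $(A,\cdot,[,],\alpha)$ is $(V,\lambda^l,\lambda^r,\rho^l,\rho^r,\phi)$ such that $(V,\lambda^l,\lambda^r,\phi)$ is a representation of $(A,\cdot,\alpha)$, $(V,\rho^l,\rho^r,\phi)$ is a representation of $(A,[,],\alpha)$, and for all $x,y\in A$: $\rho^r(\alpha(y))\lambda^l(x)=\lambda^l(\alpha(x))\rho^r(y)+\lambda^l([x,y])\phi$; $\rho^r(\alpha(y))\lambda^r(x)=\lambda^r([x,y])\phi+\lambda^r(\alpha(x))\rho^r(y)$; $\rho^l(x\cdot y)\phi=\lambda^l(\alpha(x))\rho^l(y)+\lambda^r(\alpha(y))\rho^l(x)$. Matched pair of Hom-associative algebras $((A_1,\lambda_2^l,\lambda_2^r,\alpha_1),(A_2,\lambda_1^l,\lambda_1^r,\alpha_2))$, for Hom-associative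 $(A_1,\cdot,\alpha_1)$, $(A_2,\bullet,\alpha_2)$: $(A_2,\lambda_1^l,\lambda_1^r,\alpha_2)$ is a representation of $(A_1,\cdot,\alpha_1)$, $(A_1,\lambda_2^l,\lambda_2^r,\alpha_1)$ is a representation of $(A_2,\bullet,\alpha_2)$, and for all $x,y\in A_1$, $u,v\in A_2$: - $\lambda_1^l(\alpha_1(x))(u\bullet v)=\lambda_1^l(\lambda_2^r(u)x)\alpha_2(v)+(\lambda_1^l(x)u)\bullet\alpha_2(v)$; - $\lambda_1^r(\alpha_1(x))(u\bullet v)=\lambda_1^r(\lambda_2^l(v)x)\alpha_2(u)+\alpha_2(u)\bullet(\lambda_1^r(x)v)$; - $\lambda_2^l(\alpha_2(u))(x\cdot y)=\lambda_2^l(\lambda_1^r(x)u)\alpha_1(y)+(\lambda_2^l(u)x)\cdot\alpha_1(y)$; - $\lambda_2^r(\alpha_2(u))(x\cdot y)=\lambda_2^r(\lambda_1^l(y)u)\alpha_1(x)+\alpha_1(x)\cdot(\lambda_2^r(u)y)$; - $\lambda_1^l(\lambda_2^l(u)x)\alpha_2(v)+(\lambda_1^r(x)u)\bullet\alpha_2(v)-\lambda_1^r(\lambda_2^r(v)x)\alpha_2(u)-\alpha_2(u)\bullet(\lambda_1^l(x)v)=0$; - $\lambda_2^l(\lambda_1^l(x)u)\alpha_1(y)+(\lambda_2^r(u)x)\cdot\alpha_1(y)-\lambda_2^r(\lambda_1^r(y)u)\alpha_1(x)-\alpha_1(x)\cdot(\lambda_2^l(u)y)=0$. Matched pair of Hom-Leibniz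 algebras $((A_1,\rho_2^l,\rho_2^r,\alpha_1),(A_2,\rho_1^l,\rho_1^r,\alpha_2))$, for Hom-Leibniz $(A_1,[,]_1,\alpha_1)$, $(A_2,[,]_2,\alpha_2)$: $(A_2,\rho_1^l,\rho_1^r,\alpha_2)$ is a representation of $(A_1,[,]_1,\alpha_1)$, $(A_1,\rho_2^l,\rho_2^r,\alpha_1)$ is a representation of $(A_2,[,]_2,\alpha_2)$, and for all $x,y\in A_1$, $u,v\in A_2$: - $\rho_1^r(\alpha_1(x))[u,v]_2-[\alpha_2(u),\rho_1^r(x)v]_2-[\rho_1^r(x)u,\alpha_2(v)]_2-\rho_1^r(\rho_2^l(v)x)\alpha_2(u)-\rho_1^l(\rho_2^l(u)x)\alpha_2(v)=0$; - $\rho_1^l(\alpha_1(x))[u,v]_2-[\rho_1^l(x)u,\alpha_2(v)]_2+[\rho_1^l(x)v,\alpha_2(u)]_2-\rho_1^l(\rho_2^r(u)x)\alpha_2(v)+\rho_1^l(\rho_2^r(v)x)\alpha_2(u)=0$; - $\rho_1^r(\alpha_1(x))[u,v]_2-[\rho_1^r(x)u,\alpha_2(v)]_2+[\alpha_2(u),\rho_1^l(x)v]_2-\rho_1^l(\rho_2^l(u)x)\alpha_2(v)+\rho_1^r(\rho_2^r(v)x)\alpha_2(u)=0$; - $\rho_2^r(\alpha_2(u))[x,y]_1-[\alpha_1(x),\rho_2^r(u)y]_1-[\rho_2^r(u)x,\alpha_1(y)]_1-\rho_2^r(\rho_1^l(y)u)\alpha_1(x)-\rho_2^l(\rho_1^l(x)u)\alpha_1(y)=0$;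 - $\rho_2^l(\alpha_2(u))[x,y]_1-[\rho_2^l(u)x,\alpha_1(y)]_1+[\rho_2^l(u)y,\alpha_1(x)]_1-\rho_2^l(\rho_1^r(x)u)\alpha_1(y)+\rho_2^l(\rho_1^r(y)u)\alpha_1(x)=0$; - $\rho_2^r(\alpha_2(u))[x,y]_1-[\rho_2^r(u)x,\alpha_1(y)]_1+[\alpha_1(x),\rho_2^l(u)y]_1-\rho_2^l(\rho_1^l(x)u)\alpha_1(y)+\rho_2^r(\rho_1^r(y)u)\alpha_1(x)=0$. Matched pair of Hom-Leibniz Poisson algebras $((A_1,\lambda_2^l,\lambda_2^r,\rho_2^l,\rho_2^r,\alpha_1),(A_2,\lambda_1^l,\lambda_1^r,\rho_1^l,\rho_1^r,\alpha_2))$: $(A_2,\lambda_1^l,\lambda_1^r,\rho_1^l,\rho_1^r,\alpha_2)$ is a representation of $\mathcal A_1$, $(A_1,\lambda_2^l,\lambda_2^r,\rho_2^l,\rho_2^r,\alpha_1)$ is a representation of $\mathcal A_2$, the $\lambda$'s form a matched pair of Hom-associative algebras, the $\rho$'s form a matched pair of Hom-Leibniz algebras, and for all $x,y\in A_1$, $u,v\in A_2$: - $\lambda_2^l(\alpha_2(u))[x,y]_1+(\rho_2^l(u)y)\cdot\alpha_1(x)+\lambda_2^l(\rho_1^r(y)u)\alpha_1(x)-[\lambda_2^l(u)x,\alpha_1(y)]_1-\rho_2^l(\lambda_1^r(x)u)\alpha_1(y)=0$; - $\lambda_2^r(\alpha_2(u))[x,y]_1+\alpha_1(x)\cdot(\rho_2^l(u)y)+\lambda_2^r(\rho_1^r(y)u)\alpha_1(x)-[\lambda_2^r(u)x,\alpha_1(y)]_1-\rho_2^l(\lambda_1^l(x)u)\alpha_1(y)=0$;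 - $\lambda_1^l(\alpha_1(x))[u,v]_2+(\rho_1^l(x)v)\bullet\alpha_2(u)+\lambda_1^l(\rho_2^r(v)x)\alpha_2(u)-[\lambda_1^l(x)u,\alpha_2(v)]_2-\rho_1^l(\lambda_2^r(u)x)\alpha_2(v)=0$; - $\lambda_1^r(\alpha_1(x))[u,v]_2+\alpha_2(u)\bullet(\rho_1^l(x)v)+\lambda_1^r(\rho_2^r(v)x)\alpha_2(u)-[\lambda_1^r(x)u,\alpha_2(v)]_2-\rho_1^l(\lambda_2^l(u)x)\alpha_2(v)=0$; - $\rho_2^r(\alpha_2(u))(x\cdot y)-\alpha_1(x)\cdot(\rho_2^r(u)y)-\lambda_2^r(\rho_1^l(y)u)\alpha_1(x)-(\rho_2^r(u)x)\cdot\alpha_1(y)-\lambda_2^l(\rho_1^l(x)u)\alpha_1(y)=0$; - $\rho_1^r(\alpha_1(x))(u\bullet v)-\alpha_2(u)\bullet(\rho_1^r(x)v)-\lambda_1^r(\rho_2^l(v)x)\alpha_2(u)-(\rho_1^r(x)u)\bullet\alpha_2(v)-\lambda_1^l(\rho_2^l(u)x)\alpha_2(v)=0$. *)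

theory Defs
  imports "HOL-Analysis.Product_Vector"
begin

locale hom_vector_space = vector_space scale
  for scale :: "'k::field_char_0 \<Rightarrow> 'a::ab_group_add \<Rightarrow> 'a" +
  fixes \<alpha> :: "'a \<Rightarrow> 'a"
  assumes twist_linear: "Vector_Spaces.linear scale scale \<alpha>"

definition bilinear_map ::
  "('k::field \<Rightarrow> 'a::ab_group_add \<Rightarrow> 'a) \<Rightarrow> ('k \<Rightarrow> 'b::ab_group_add \<Rightarrow> 'b) \<Rightarrow>
   ('k \<Rightarrow> 'c::ab_group_add \<Rightarrow> 'c) \<Rightarrow> ('a \<Rightarrow> 'b \<Rightarrow> 'c) \<Rightarrow> bool"
  where "bilinear_map s1 s2 s3 f \<longleftrightarrow>
    (\<forall>x. Vector_Spaces.linear s2 s3 (f x)) \<and> (\<forall>y. Vector_Spaces.linear s1 s3 (\<lambda>x. f x y))"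

(* A linear map l : A -> gl(V): each l x is an endomorphism of V, and l is linear for the
   pointwise vector space structure of gl(V). *)
definition linear_to_gl ::
  "('k::field \<Rightarrow> 'a::ab_group_add \<Rightarrow> 'a) \<Rightarrow> ('k \<Rightarrow> 'v::ab_group_add \<Rightarrow> 'v) \<Rightarrow>
   ('a \<Rightarrow> 'v \<Rightarrow> 'v) \<Rightarrow> bool"
  where "linear_to_gl s sV l \<longleftrightarrow>
    (\<forall>x. Vector_Spaces.linear sV sV (l x)) \<and> (\<forall>v. Vector_Spaces.linear s sV (\<lambda>x. l x v))"

locale hom_associative_algebra = hom_vector_space scale \<alpha>
  for scale :: "'k::field_char_0 \<Rightarrow> 'a::ab_group_add \<Rightarrow> 'a"
    and mult :: "'a \<Rightarrow> 'a \<Rightarrow> 'a" (infixl "\<cdot>" 70)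
    and \<alpha> :: "'a \<Rightarrow> 'a" +
  assumes mult_bilinear: "bilinear_map scale scale scale (\<cdot>)"
    and twist_mult: "\<alpha> (x \<cdot> y) = \<alpha> x \<cdot> \<alpha> y"
    and hom_assoc: "(x \<cdot> y) \<cdot> \<alpha> z = \<alpha> x \<cdot> (y \<cdot> z)"

locale hom_leibniz_algebra = hom_vector_space scale \<alpha>
  for scale :: "'k::field_char_0 \<Rightarrow> 'a::ab_group_add \<Rightarrow> 'a"
    and br :: "'a \<Rightarrow> 'a \<Rightarrow> 'a"
    and \<alpha> :: "'a \<Rightarrow> 'a" +
  assumes br_bilinear: "bilinear_map scale scale scale br"
    and twist_br: "\<alpha> (br x y) = br (\<alpha> x) (\<alpha> y)"
    and hom_leibniz: "br (br x y) (\<alpha> z) = br (\<alpha> x) (br y z) + br (br x z) (\<alpha> y)"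

locale hom_leibniz_poisson_algebra =
  hom_associative_algebra scale mult \<alpha> + hom_leibniz_algebra scale br \<alpha>
  for scale :: "'k::field_char_0 \<Rightarrow> 'a::ab_group_add \<Rightarrow> 'a"
    and mult :: "'a \<Rightarrow> 'a \<Rightarrow> 'a" (infixl "\<cdot>" 70)
    and br :: "'a \<Rightarrow> 'a \<Rightarrow> 'a"
    and \<alpha> :: "'a \<Rightarrow> 'a" +
  assumes hom_poisson: "br (x \<cdot> y) (\<alpha> z) = \<alpha> x \<cdot> br y z + br x z \<cdot> \<alpha> y"

(* The operator identities in gl(V) below are stated pointwise, at every vector v. *)

locale hom_associative_representation =
  hom_associative_algebra scale mult \<alpha> + V: hom_vector_space scaleV \<phi>
  for scale :: "'k::field_char_0 \<Rightarrow> 'a::ab_group_add \<Rightarrow> 'a"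
    and mult :: "'a \<Rightarrow> 'a \<Rightarrow> 'a" (infixl "\<cdot>" 70)
    and \<alpha> :: "'a \<Rightarrow> 'a"
    and scaleV :: "'k \<Rightarrow> 'v::ab_group_add \<Rightarrow> 'v"
    and lam_l lam_r :: "'a \<Rightarrow> 'v \<Rightarrow> 'v"
    and \<phi> :: "'v \<Rightarrow> 'v" +
  assumes lam_l_linear: "linear_to_gl scale scaleV lam_l"
    and lam_r_linear: "linear_to_gl scale scaleV lam_r"
    and \<phi>_lam_l: "\<phi> (lam_l x v) = lam_l (\<alpha> x) (\<phi> v)"
    and \<phi>_lam_r: "\<phi> (lam_r x v) = lam_r (\<alpha> x) (\<phi> v)"
    and lam_l_mult: "lam_l (x \<cdot> y) (\<phi> v) = lam_l (\<alpha> x) (lam_l y v)"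
    and lam_r_mult: "lam_r (x \<cdot> y) (\<phi> v) = lam_r (\<alpha> y) (lam_r x v)"
    and lam_l_lam_r: "lam_l (\<alpha> x) (lam_r y v) = lam_r (\<alpha> y) (lam_l x v)"

locale hom_leibniz_representation =
  hom_leibniz_algebra scale br \<alpha> + V: hom_vector_space scaleV \<phi>
  for scale :: "'k::field_char_0 \<Rightarrow> 'a::ab_group_add \<Rightarrow> 'a"
    and br :: "'a \<Rightarrow> 'a \<Rightarrow> 'a"
    and \<alpha> :: "'a \<Rightarrow> 'a"
    and scaleV :: "'k \<Rightarrow> 'v::ab_group_add \<Rightarrow> 'v"
    and rho_l rho_r :: "'a \<Rightarrow> 'v \<Rightarrow> 'v"
    and \<phi> :: "'v \<Rightarrow> 'v" +
  assumes rho_l_linear: "linear_to_gl scale scaleV rho_l"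
    and rho_r_linear: "linear_to_gl scale scaleV rho_r"
    and rho_l_\<phi>: "rho_l (\<alpha> x) (\<phi> v) = \<phi> (rho_l x v)"
    and rho_r_\<phi>: "rho_r (\<alpha> x) (\<phi> v) = \<phi> (rho_r x v)"
    and rho_l_br: "rho_l (br x y) (\<phi> v) = rho_l (\<alpha> x) (rho_l y v) + rho_r (\<alpha> y) (rho_l x v)"
    and rho_r_rho_l: "rho_r (\<alpha> y) (rho_l x v) = rho_l (\<alpha> x) (rho_r y v) + rho_l (br x y) (\<phi> v)"
    and rho_r_rho_r: "rho_r (\<alpha> y) (rho_r x v) = rho_r (br x y) (\<phi> v) + rho_r (\<alpha> x) (rho_r y v)"

locale hom_leibniz_poisson_representation =
  hom_leibniz_poisson_algebra scale mult br \<alpha> +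
  hom_associative_representation scale mult \<alpha> scaleV lam_l lam_r \<phi> +
  hom_leibniz_representation scale br \<alpha> scaleV rho_l rho_r \<phi>
  for scale :: "'k::field_char_0 \<Rightarrow> 'a::ab_group_add \<Rightarrow> 'a"
    and mult :: "'a \<Rightarrow> 'a \<Rightarrow> 'a" (infixl "\<cdot>" 70)
    and br :: "'a \<Rightarrow> 'a \<Rightarrow> 'a"
    and \<alpha> :: "'a \<Rightarrow> 'a"
    and scaleV :: "'k \<Rightarrow> 'v::ab_group_add \<Rightarrow> 'v"
    and lam_l lam_r rho_l rho_r :: "'a \<Rightarrow> 'v \<Rightarrow> 'v"
    and \<phi> :: "'v \<Rightarrow> 'v" +
  assumes rho_r_lam_l: "rho_r (\<alpha> y) (lam_l x v) = lam_l (\<alpha> x) (rho_r y v) + lam_l (br x y) (\<phi> v)"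
    and rho_r_lam_r: "rho_r (\<alpha> y) (lam_r x v) = lam_r (br x y) (\<phi> v) + lam_r (\<alpha> x) (rho_r y v)"
    and rho_l_mult: "rho_l (x \<cdot> y) (\<phi> v) = lam_l (\<alpha> x) (rho_l y v) + lam_r (\<alpha> y) (rho_l x v)"

(* In the matched pairs, the maps with index 1 are the actions A1 -> gl(A2) and those with
   index 2 the actions A2 -> gl(A1). *)

locale matched_pair_hom_associative =
  R1: hom_associative_representation s1 mult1 \<alpha>1 s2 lam_l1 lam_r1 \<alpha>2 +
  R2: hom_associative_representation s2 mult2 \<alpha>2 s1 lam_l2 lam_r2 \<alpha>1
  for s1 :: "'k::field_char_0 \<Rightarrow> 'a::ab_group_add \<Rightarrow> 'a"
    and mult1 :: "'a \<Rightarrow> 'a \<Rightarrow> 'a" (infixl "\<cdot>" 70)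
    and \<alpha>1 :: "'a \<Rightarrow> 'a"
    and lam_l2 lam_r2 :: "'b::ab_group_add \<Rightarrow> 'a \<Rightarrow> 'a"
    and s2 :: "'k \<Rightarrow> 'b::ab_group_add \<Rightarrow> 'b"
    and mult2 :: "'b \<Rightarrow> 'b \<Rightarrow> 'b" (infixl "\<bullet>" 70)
    and \<alpha>2 :: "'b \<Rightarrow> 'b"
    and lam_l1 lam_r1 :: "'a \<Rightarrow> 'b \<Rightarrow> 'b" +
  assumes assoc_compat1:
      "lam_l1 (\<alpha>1 x) (u \<bullet> v) = lam_l1 (lam_r2 u x) (\<alpha>2 v) + (lam_l1 x u) \<bullet> \<alpha>2 v"
    and assoc_compat2:
      "lam_r1 (\<alpha>1 x) (u \<bullet> v) = lam_r1 (lam_l2 v x) (\<alpha>2 u) + \<alpha>2 u \<bullet> (lam_r1 x v)"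
    and assoc_compat3:
      "lam_l2 (\<alpha>2 u) (x \<cdot> y) = lam_l2 (lam_r1 x u) (\<alpha>1 y) + (lam_l2 u x) \<cdot> \<alpha>1 y"
    and assoc_compat4:
      "lam_r2 (\<alpha>2 u) (x \<cdot> y) = lam_r2 (lam_l1 y u) (\<alpha>1 x) + \<alpha>1 x \<cdot> (lam_r2 u y)"
    and assoc_compat5:
      "lam_l1 (lam_l2 u x) (\<alpha>2 v) + (lam_r1 x u) \<bullet> \<alpha>2 v
        - lam_r1 (lam_r2 v x) (\<alpha>2 u) - \<alpha>2 u \<bullet> (lam_l1 x v) = 0"
    and assoc_compat6:
      "lam_l2 (lam_l1 x u) (\<alpha>1 y) + (lam_r2 u x) \<cdot> \<alpha>1 y
        - lam_r2 (lam_r1 y u) (\<alpha>1 x) - \<alpha>1 x \<cdot> (lam_l2 u y) = 0"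

locale matched_pair_hom_leibniz =
  R1: hom_leibniz_representation s1 br1 \<alpha>1 s2 rho_l1 rho_r1 \<alpha>2 +
  R2: hom_leibniz_representation s2 br2 \<alpha>2 s1 rho_l2 rho_r2 \<alpha>1
  for s1 :: "'k::field_char_0 \<Rightarrow> 'a::ab_group_add \<Rightarrow> 'a"
    and br1 :: "'a \<Rightarrow> 'a \<Rightarrow> 'a"
    and \<alpha>1 :: "'a \<Rightarrow> 'a"
    and rho_l2 rho_r2 :: "'b::ab_group_add \<Rightarrow> 'a \<Rightarrow> 'a"
    and s2 :: "'k \<Rightarrow> 'b::ab_group_add \<Rightarrow> 'b"
    and br2 :: "'b \<Rightarrow> 'b \<Rightarrow> 'b"
    and \<alpha>2 :: "'b \<Rightarrow> 'b"
    and rho_l1 rho_r1 :: "'a \<Rightarrow> 'b \<Rightarrow> 'b" +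
  assumes leibniz_compat1:
      "rho_r1 (\<alpha>1 x) (br2 u v) - br2 (\<alpha>2 u) (rho_r1 x v) - br2 (rho_r1 x u) (\<alpha>2 v)
        - rho_r1 (rho_l2 v x) (\<alpha>2 u) - rho_l1 (rho_l2 u x) (\<alpha>2 v) = 0"
    and leibniz_compat2:
      "rho_l1 (\<alpha>1 x) (br2 u v) - br2 (rho_l1 x u) (\<alpha>2 v) + br2 (rho_l1 x v) (\<alpha>2 u)
        - rho_l1 (rho_r2 u x) (\<alpha>2 v) + rho_l1 (rho_r2 v x) (\<alpha>2 u) = 0"
    and leibniz_compat3:
      "rho_r1 (\<alpha>1 x) (br2 u v) - br2 (rho_r1 x u) (\<alpha>2 v) + br2 (\<alpha>2 u) (rho_l1 x v)
        - rho_l1 (rho_l2 u x) (\<alpha>2 v) + rho_r1 (rho_r2 v x) (\<alpha>2 u) = 0"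
    and leibniz_compat4:
      "rho_r2 (\<alpha>2 u) (br1 x y) - br1 (\<alpha>1 x) (rho_r2 u y) - br1 (rho_r2 u x) (\<alpha>1 y)
        - rho_r2 (rho_l1 y u) (\<alpha>1 x) - rho_l2 (rho_l1 x u) (\<alpha>1 y) = 0"
    and leibniz_compat5:
      "rho_l2 (\<alpha>2 u) (br1 x y) - br1 (rho_l2 u x) (\<alpha>1 y) + br1 (rho_l2 u y) (\<alpha>1 x)
        - rho_l2 (rho_r1 x u) (\<alpha>1 y) + rho_l2 (rho_r1 y u) (\<alpha>1 x) = 0"
    and leibniz_compat6:
      "rho_r2 (\<alpha>2 u) (br1 x y) - br1 (rho_r2 u x) (\<alpha>1 y) + br1 (\<alpha>1 x) (rho_l2 u y)
        - rho_l2 (rho_l1 x u) (\<alpha>1 y) + rho_r2 (rho_r1 y u) (\<alpha>1 x) = 0"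

locale matched_pair_hom_leibniz_poisson =
  R1: hom_leibniz_poisson_representation s1 mult1 br1 \<alpha>1 s2 lam_l1 lam_r1 rho_l1 rho_r1 \<alpha>2 +
  R2: hom_leibniz_poisson_representation s2 mult2 br2 \<alpha>2 s1 lam_l2 lam_r2 rho_l2 rho_r2 \<alpha>1 +
  matched_pair_hom_associative s1 mult1 \<alpha>1 lam_l2 lam_r2 s2 mult2 \<alpha>2 lam_l1 lam_r1 +
  matched_pair_hom_leibniz s1 br1 \<alpha>1 rho_l2 rho_r2 s2 br2 \<alpha>2 rho_l1 rho_r1
  for s1 :: "'k::field_char_0 \<Rightarrow> 'a::ab_group_add \<Rightarrow> 'a"
    and mult1 :: "'a \<Rightarrow> 'a \<Rightarrow> 'a" (infixl "\<cdot>" 70)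
    and br1 :: "'a \<Rightarrow> 'a \<Rightarrow> 'a"
    and \<alpha>1 :: "'a \<Rightarrow> 'a"
    and lam_l2 lam_r2 rho_l2 rho_r2 :: "'b::ab_group_add \<Rightarrow> 'a \<Rightarrow> 'a"
    and s2 :: "'k \<Rightarrow> 'b::ab_group_add \<Rightarrow> 'b"
    and mult2 :: "'b \<Rightarrow> 'b \<Rightarrow> 'b" (infixl "\<bullet>" 70)
    and br2 :: "'b \<Rightarrow> 'b \<Rightarrow> 'b"
    and \<alpha>2 :: "'b \<Rightarrow> 'b"
    and lam_l1 lam_r1 rho_l1 rho_r1 :: "'a \<Rightarrow> 'b \<Rightarrow> 'b" +
  assumes poisson_compat1:
      "lam_l2 (\<alpha>2 u) (br1 x y) + (rho_l2 u y) \<cdot> \<alpha>1 x + lam_l2 (rho_r1 y u) (\<alpha>1 x)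
        - br1 (lam_l2 u x) (\<alpha>1 y) - rho_l2 (lam_r1 x u) (\<alpha>1 y) = 0"
    and poisson_compat2:
      "lam_r2 (\<alpha>2 u) (br1 x y) + \<alpha>1 x \<cdot> (rho_l2 u y) + lam_r2 (rho_r1 y u) (\<alpha>1 x)
        - br1 (lam_r2 u x) (\<alpha>1 y) - rho_l2 (lam_l1 x u) (\<alpha>1 y) = 0"
    and poisson_compat3:
      "lam_l1 (\<alpha>1 x) (br2 u v) + (rho_l1 x v) \<bullet> \<alpha>2 u + lam_l1 (rho_r2 v x) (\<alpha>2 u)
        - br2 (lam_l1 x u) (\<alpha>2 v) - rho_l1 (lam_r2 u x) (\<alpha>2 v) = 0"
    and poisson_compat4:
      "lam_r1 (\<alpha>1 x) (br2 u v) + \<alpha>2 u \<bullet> (rho_l1 x v) + lam_r1 (rho_r2 v x) (\<alpha>2 u)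
        - br2 (lam_r1 x u) (\<alpha>2 v) - rho_l1 (lam_l2 u x) (\<alpha>2 v) = 0"
    and poisson_compat5:
      "rho_r2 (\<alpha>2 u) (x \<cdot> y) - \<alpha>1 x \<cdot> (rho_r2 u y) - lam_r2 (rho_l1 y u) (\<alpha>1 x)
        - (rho_r2 u x) \<cdot> \<alpha>1 y - lam_l2 (rho_l1 x u) (\<alpha>1 y) = 0"
    and poisson_compat6:
      "rho_r1 (\<alpha>1 x) (u \<bullet> v) - \<alpha>2 u \<bullet> (rho_r1 x v) - lam_r1 (rho_l2 v x) (\<alpha>2 u)
        - (rho_r1 x u) \<bullet> \<alpha>2 v - lam_l1 (rho_l2 u x) (\<alpha>2 v) = 0"

end

(* Expanding each axiom by additivity on triples of homogeneous vectors, its A1- and A2-components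
   are exactly the algebra axioms, the representation axioms and the compatibility conditions. *)
theory Submission
  imports Defs
begin

text \<open>Every axiom of the direct sum is multi-additive, so it splits according to which
  arguments lie in A1 and which in A2. With all arguments in one summand it is an axiom of that
  algebra. With exactly one argument in the other summand, the component in that other summand is a
  representation axiom, and the component in the majority summand is a compatibility condition, one
  for each position of the lone argument. Product and bracket are two instances of
  \<open>bicrossed_product\<close>, so bilinearity is proved once for both;
  \<open>sum_mult_assoc\<close>, \<open>sum_br_leibniz\<close> and \<open>sum_poisson\<close> carry
  the three ternary identities.\<close>

text \<open>Uncurrying: actions can then be treated exactly like products and brackets.\<close>

lemma linear_to_gl_iff_bilinear_map: "linear_to_gl s sV l \<longleftrightarrow> bilinear_map s sV sV l"
  by (simp add: linear_to_gl_def bilinear_map_def)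

lemma bilinear_map_iff:
  "bilinear_map s1 s2 s3 f \<longleftrightarrow>
    vector_space s1 \<and> vector_space s2 \<and> vector_space s3 \<and>
    (\<forall>x y z. f (x + y) z = f x z + f y z) \<and> (\<forall>x y z. f x (y + z) = f x y + f x z) \<and>
    (\<forall>c x y. f (s1 c x) y = s3 c (f x y)) \<and> (\<forall>c x y. f x (s2 c y) = s3 c (f x y))"
  by (auto simp: bilinear_map_def Vector_Spaces.linear_iff)

lemma bilinear_map_add:
  assumes "bilinear_map s1 s2 s3 f"
  shows "f (x + y) z = f x z + f y z" and "f x (z + w) = f x z + f x w"
  using assms by (auto simp: bilinear_map_iff)

text \<open>The direct sum is modelled by the product type. The first three arguments determine the
  A1-component and the last three the A2-component; the pair \<open>l\<close>, \<open>r\<close> is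
  either the lambdas or the rhos.\<close>

definition bicrossed_product ::
  "('a::ab_group_add \<Rightarrow> 'a \<Rightarrow> 'a) \<Rightarrow> ('b::ab_group_add \<Rightarrow> 'a \<Rightarrow> 'a) \<Rightarrow> ('b \<Rightarrow> 'a \<Rightarrow> 'a) \<Rightarrow>
   ('b \<Rightarrow> 'b \<Rightarrow> 'b) \<Rightarrow> ('a \<Rightarrow> 'b \<Rightarrow> 'b) \<Rightarrow> ('a \<Rightarrow> 'b \<Rightarrow> 'b) \<Rightarrow>
   'a \<times> 'b \<Rightarrow> 'a \<times> 'b \<Rightarrow> 'a \<times> 'b"
  where "bicrossed_product m1 l2 r2 m2 l1 r1 =
    (\<lambda>(x, u) (y, v). (m1 x y + l2 u y + r2 v x, m2 u v + l1 x v + r1 y u))"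

lemma bicrossed_product_Pair [simp]:
  "bicrossed_product m1 l2 r2 m2 l1 r1 (x, u) (y, v) =
    (m1 x y + l2 u y + r2 v x, m2 u v + l1 x v + r1 y u)"
  by (simp add: bicrossed_product_def)

lemma bilinear_bicrossed_product:
  assumes "bilinear_map s1 s1 s1 m1" and "bilinear_map s2 s2 s2 m2"
    and "bilinear_map s1 s2 s2 l1" and "bilinear_map s1 s2 s2 r1"
    and "bilinear_map s2 s1 s1 l2" and "bilinear_map s2 s1 s1 r2"
  shows "bilinear_map (module_prod.scale s1 s2) (module_prod.scale s1 s2) (module_prod.scale s1 s2)
    (bicrossed_product m1 l2 r2 m2 l1 r1)"
proof -
  interpret vector_space_prod s1 s2
    using assms by (simp add: vector_space_prod_def vector_space_pair_def bilinear_map_iff)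
  show ?thesis
    using assms by (auto simp: bilinear_map_iff p.vector_space_axioms scale_prod
        vs1.scale_right_distrib vs2.scale_right_distrib add_ac)
qed

lemma (in hom_vector_space) twist_add: "\<alpha> (x + y) = \<alpha> x + \<alpha> y"
  using twist_linear by (simp add: Vector_Spaces.linear_iff)

lemma hom_vector_space_map_prod:
  assumes "hom_vector_space s1 \<alpha>1" and "hom_vector_space s2 \<alpha>2"
  shows "hom_vector_space (module_prod.scale s1 s2) (map_prod \<alpha>1 \<alpha>2)"
proof -
  interpret A1: hom_vector_space s1 \<alpha>1 by fact
  interpret A2: hom_vector_space s2 \<alpha>2 by fact
  interpret vector_space_prod s1 s2 by unfold_locales
  show ?thesis
    using A1.twist_linear A2.twist_linear
    by unfold_locales (auto simp: Vector_Spaces.linear_iff scale_prod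
      p.vector_space_axioms)
qed

context matched_pair_hom_associative
begin

abbreviation sum_mult :: "'a \<times> 'b \<Rightarrow> 'a \<times> 'b \<Rightarrow> 'a \<times> 'b"
  where "sum_mult \<equiv> bicrossed_product mult1 lam_l2 lam_r2 mult2 lam_l1 lam_r1"

lemmas assoc_bilinear_maps =
  R1.mult_bilinear R2.mult_bilinear
  R1.lam_l_linear[unfolded linear_to_gl_iff_bilinear_map]
  R1.lam_r_linear[unfolded linear_to_gl_iff_bilinear_map]
  R2.lam_l_linear[unfolded linear_to_gl_iff_bilinear_map]
  R2.lam_r_linear[unfolded linear_to_gl_iff_bilinear_map]

lemmas assoc_bilinear = assoc_bilinear_maps[THEN bilinear_map_add(1)]
  assoc_bilinear_maps[THEN bilinear_map_add(2)]

text \<open>For one argument from A1 and two from A2, the A2-component is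
  \<open>assoc_compat1\<close>, \<open>assoc_compat5\<close> or \<open>assoc_compat2\<close> as the
  A1-argument stands first, in the middle or last; \<open>assoc_compat3\<close>,
  \<open>assoc_compat4\<close> and \<open>assoc_compat6\<close> are the mirror cases.\<close>

lemma sum_mult_assoc:
  "sum_mult (sum_mult a b) (map_prod \<alpha>1 \<alpha>2 c) = sum_mult (map_prod \<alpha>1 \<alpha>2 a) (sum_mult b c)"
proof -
  have compat5: "(lam_r1 x u) \<bullet> \<alpha>2 v = lam_r1 (lam_r2 v x) (\<alpha>2 u) + \<alpha>2 u \<bullet> (lam_l1 x v)
      - lam_l1 (lam_l2 u x) (\<alpha>2 v)" for x u v
    using assoc_compat5[of u x v] by (simp add: algebra_simps)
  have compat6: "(lam_r2 u x) \<cdot> \<alpha>1 y = lam_r2 (lam_r1 y u) (\<alpha>1 x) + \<alpha>1 x \<cdot> (lam_l2 u y)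
      - lam_l2 (lam_l1 x u) (\<alpha>1 y)" for x u y
    using assoc_compat6[of x u y] by (simp add: algebra_simps)
  show ?thesis
    by (cases a; cases b; cases c)
      \<comment> \<open>Expansion with the algebra and representation axioms comes first, then the
        compatibility conditions; what remains is an identity of sums in an abelian group.\<close>
      (simp add: assoc_bilinear R1.hom_assoc R2.hom_assoc R1.lam_l_mult R2.lam_l_mult
        R1.lam_r_mult R2.lam_r_mult R1.lam_l_lam_r R2.lam_l_lam_r,
        simp only: assoc_compat1 assoc_compat2 assoc_compat3 assoc_compat4 compat5 compat6,
        simp add: algebra_simps)
qed

text \<open>On mixed arguments, multiplicativity of the twist says that the twists intertwine the
  actions, which is part of being a representation.\<close>

lemma hom_associative_algebra_sum:
  "hom_associative_algebra (module_prod.scale s1 s2) sum_mult (map_prod \<alpha>1 \<alpha>2)"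
proof -
  interpret hom_vector_space "module_prod.scale s1 s2" "map_prod \<alpha>1 \<alpha>2"
    by (rule hom_vector_space_map_prod) unfold_locales
  show ?thesis
  proof
    show "bilinear_map (module_prod.scale s1 s2) (module_prod.scale s1 s2)
        (module_prod.scale s1 s2) sum_mult"
      by (intro bilinear_bicrossed_product assoc_bilinear_maps)
    fix a b c
    show "map_prod \<alpha>1 \<alpha>2 (sum_mult a b) = sum_mult (map_prod \<alpha>1 \<alpha>2 a) (map_prod \<alpha>1 \<alpha>2 b)"
      by (cases a; cases b)
        (simp add: R1.twist_add R1.V.twist_add R1.twist_mult R2.twist_mult
          R1.\<phi>_lam_l R2.\<phi>_lam_l R1.\<phi>_lam_r R2.\<phi>_lam_r)
    show "sum_mult (sum_mult a b) (map_prod \<alpha>1 \<alpha>2 c) = sum_mult (map_prod \<alpha>1 \<alpha>2 a) (sum_mult b c)"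
      by (rule sum_mult_assoc)
  qed
qed

end

context matched_pair_hom_leibniz
begin

abbreviation sum_br :: "'a \<times> 'b \<Rightarrow> 'a \<times> 'b \<Rightarrow> 'a \<times> 'b"
  where "sum_br \<equiv> bicrossed_product br1 rho_l2 rho_r2 br2 rho_l1 rho_r1"

lemmas leibniz_bilinear_maps =
  R1.br_bilinear R2.br_bilinear
  R1.rho_l_linear[unfolded linear_to_gl_iff_bilinear_map]
  R1.rho_r_linear[unfolded linear_to_gl_iff_bilinear_map]
  R2.rho_l_linear[unfolded linear_to_gl_iff_bilinear_map]
  R2.rho_r_linear[unfolded linear_to_gl_iff_bilinear_map]

lemmas leibniz_bilinear = leibniz_bilinear_maps[THEN bilinear_map_add(1)]
  leibniz_bilinear_maps[THEN bilinear_map_add(2)]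

text \<open>The lone argument stands last in \<open>leibniz_compat1\<close> and
  \<open>leibniz_compat4\<close>, first in \<open>leibniz_compat2\<close> and
  \<open>leibniz_compat5\<close>, in the middle in \<open>leibniz_compat3\<close> and
  \<open>leibniz_compat6\<close>.\<close>

lemma sum_br_leibniz:
  "sum_br (sum_br a b) (map_prod \<alpha>1 \<alpha>2 c) =
    sum_br (map_prod \<alpha>1 \<alpha>2 a) (sum_br b c) + sum_br (sum_br a c) (map_prod \<alpha>1 \<alpha>2 b)"
proof -
  \<comment> \<open>The Leibniz axioms loop when used left to right, and \<open>leibniz_compat3\<close>, \<open>leibniz_compat6\<close> and
    \<open>rho_r_rho_l\<close> share their leading terms with \<open>leibniz_compat1\<close>, \<open>leibniz_compat4\<close> and \<open>rho_l_br\<close>;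
    solving for other terms turns all of them into a terminating rewrite system.\<close>
  have compat1: "rho_r1 (\<alpha>1 x) (br2 u v) = br2 (\<alpha>2 u) (rho_r1 x v) + br2 (rho_r1 x u) (\<alpha>2 v)
      + rho_r1 (rho_l2 v x) (\<alpha>2 u) + rho_l1 (rho_l2 u x) (\<alpha>2 v)" for x u v
    using leibniz_compat1[of x u v] by (simp add: algebra_simps)
  have compat4: "rho_r2 (\<alpha>2 u) (br1 x y) = br1 (\<alpha>1 x) (rho_r2 u y) + br1 (rho_r2 u x) (\<alpha>1 y)
      + rho_r2 (rho_l1 y u) (\<alpha>1 x) + rho_l2 (rho_l1 x u) (\<alpha>1 y)" for x y u
    using leibniz_compat4[of u x y] by (simp add: algebra_simps)
  have compat2: "rho_l1 (\<alpha>1 x) (br2 u v) = br2 (rho_l1 x u) (\<alpha>2 v) - br2 (rho_l1 x v) (\<alpha>2 u)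
      + rho_l1 (rho_r2 u x) (\<alpha>2 v) - rho_l1 (rho_r2 v x) (\<alpha>2 u)" for x u v
    using leibniz_compat2[of x u v] by (simp add: algebra_simps)
  have compat5: "rho_l2 (\<alpha>2 u) (br1 x y) = br1 (rho_l2 u x) (\<alpha>1 y) - br1 (rho_l2 u y) (\<alpha>1 x)
      + rho_l2 (rho_r1 x u) (\<alpha>1 y) - rho_l2 (rho_r1 y u) (\<alpha>1 x)" for x y u
    using leibniz_compat5[of u x y] by (simp add: algebra_simps)
  \<comment> \<open>Adding the Leibniz rule to itself with the last two arguments swapped shows that
    bracketing a twisted element on the left with {b,c} + {c,b} gives 0. \<open>compat3\<close> and
    \<open>compat6\<close> are mixed components of this consequence, as are
    \<open>rho_l_rho_r1\<close> and \<open>rho_l_rho_r2\<close> below.\<close>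
  have compat3: "br2 (\<alpha>2 u) (rho_l1 x v) = - br2 (\<alpha>2 u) (rho_r1 x v)
      - rho_r1 (rho_l2 v x) (\<alpha>2 u) - rho_r1 (rho_r2 v x) (\<alpha>2 u)" for x u v
    using leibniz_compat3[of x u v] unfolding compat1 by (simp add: algebra_simps eq_neg_iff_add_eq_0)
  have compat6: "br1 (\<alpha>1 x) (rho_l2 u y) = - br1 (\<alpha>1 x) (rho_r2 u y)
      - rho_r2 (rho_l1 y u) (\<alpha>1 x) - rho_r2 (rho_r1 y u) (\<alpha>1 x)" for x u y
    using leibniz_compat6[of u x y] unfolding compat4 by (simp add: algebra_simps eq_neg_iff_add_eq_0)
  have leibniz1: "br1 (\<alpha>1 x) (br1 y z) = br1 (br1 x y) (\<alpha>1 z) - br1 (br1 x z) (\<alpha>1 y)" for x y z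
    using R1.hom_leibniz[of x y z] by simp
  have leibniz2: "br2 (\<alpha>2 u) (br2 v w) = br2 (br2 u v) (\<alpha>2 w) - br2 (br2 u w) (\<alpha>2 v)" for u v w
    using R2.hom_leibniz[of u v w] by simp
  have rho_r_br1: "rho_r1 (br1 x y) (\<alpha>2 v) = rho_r1 (\<alpha>1 y) (rho_r1 x v) - rho_r1 (\<alpha>1 x) (rho_r1 y v)"
    for x y v
    using R1.rho_r_rho_r[of y x v] by (simp add: algebra_simps)
  have rho_r_br2: "rho_r2 (br2 u v) (\<alpha>1 x) = rho_r2 (\<alpha>2 v) (rho_r2 u x) - rho_r2 (\<alpha>2 u) (rho_r2 v x)"
    for u v x
    using R2.rho_r_rho_r[of v u x] by (simp add: algebra_simps)
  have rho_l_rho_r1: "rho_l1 (\<alpha>1 x) (rho_r1 y v) = - rho_l1 (\<alpha>1 x) (rho_l1 y v)" for x y v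
    using R1.rho_r_rho_l[of y x v] unfolding R1.rho_l_br
    by (simp add: algebra_simps eq_neg_iff_add_eq_0)
  have rho_l_rho_r2: "rho_l2 (\<alpha>2 u) (rho_r2 v x) = - rho_l2 (\<alpha>2 u) (rho_l2 v x)" for u v x
    using R2.rho_r_rho_l[of v u x] unfolding R2.rho_l_br
    by (simp add: algebra_simps eq_neg_iff_add_eq_0)
  show ?thesis
    by (cases a; cases b; cases c)
      (simp add: leibniz_bilinear leibniz1 leibniz2 R1.rho_l_br R2.rho_l_br
        rho_r_br1 rho_r_br2 rho_l_rho_r1 rho_l_rho_r2,
        simp only: compat1 compat2 compat3 compat4 compat5 compat6,
        simp add: algebra_simps)
qed

lemma hom_leibniz_algebra_sum:
  "hom_leibniz_algebra (module_prod.scale s1 s2) sum_br (map_prod \<alpha>1 \<alpha>2)"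
proof -
  interpret hom_vector_space "module_prod.scale s1 s2" "map_prod \<alpha>1 \<alpha>2"
    by (rule hom_vector_space_map_prod) unfold_locales
  show ?thesis
  proof
    show "bilinear_map (module_prod.scale s1 s2) (module_prod.scale s1 s2)
        (module_prod.scale s1 s2) sum_br"
      by (intro bilinear_bicrossed_product leibniz_bilinear_maps)
    fix a b c
    show "map_prod \<alpha>1 \<alpha>2 (sum_br a b) = sum_br (map_prod \<alpha>1 \<alpha>2 a) (map_prod \<alpha>1 \<alpha>2 b)"
      by (cases a; cases b)
        (simp add: R1.twist_add R1.V.twist_add R1.twist_br R2.twist_br
          R1.rho_l_\<phi> R2.rho_l_\<phi> R1.rho_r_\<phi> R2.rho_r_\<phi>)
    show "sum_br (sum_br a b) (map_prod \<alpha>1 \<alpha>2 c) =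
        sum_br (map_prod \<alpha>1 \<alpha>2 a) (sum_br b c) + sum_br (sum_br a c) (map_prod \<alpha>1 \<alpha>2 b)"
      by (rule sum_br_leibniz)
  qed
qed

end

context matched_pair_hom_leibniz_poisson
begin

text \<open>A lone argument from A2 in the first factor, the second factor or the outer bracket slot
  gives, in the A1-component, \<open>poisson_compat1\<close>, \<open>poisson_compat2\<close> or
  \<open>poisson_compat5\<close>; \<open>poisson_compat3\<close>, \<open>poisson_compat4\<close> and
  \<open>poisson_compat6\<close> are the same with the algebras exchanged.\<close>

lemma sum_poisson:
  "sum_br (sum_mult a b) (map_prod \<alpha>1 \<alpha>2 c) =
    sum_mult (map_prod \<alpha>1 \<alpha>2 a) (sum_br b c) + sum_mult (sum_br a c) (map_prod \<alpha>1 \<alpha>2 b)"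
proof -
  \<comment> \<open>Each condition is solved for a term that only the left side of the Poisson
    identity produces: the bracket of a mixed product, or the right action on a product.\<close>
  have compat1: "br1 (lam_l2 u x) (\<alpha>1 y) = lam_l2 (\<alpha>2 u) (br1 x y) + (rho_l2 u y) \<cdot> \<alpha>1 x
      + lam_l2 (rho_r1 y u) (\<alpha>1 x) - rho_l2 (lam_r1 x u) (\<alpha>1 y)" for x y u
    using poisson_compat1[of u x y] by (simp add: algebra_simps)
  have compat2: "br1 (lam_r2 u x) (\<alpha>1 y) = lam_r2 (\<alpha>2 u) (br1 x y) + \<alpha>1 x \<cdot> (rho_l2 u y)
      + lam_r2 (rho_r1 y u) (\<alpha>1 x) - rho_l2 (lam_l1 x u) (\<alpha>1 y)" for x y u
    using poisson_compat2[of u x y] by (simp add: algebra_simps)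
  have compat3: "br2 (lam_l1 x u) (\<alpha>2 v) = lam_l1 (\<alpha>1 x) (br2 u v) + (rho_l1 x v) \<bullet> \<alpha>2 u
      + lam_l1 (rho_r2 v x) (\<alpha>2 u) - rho_l1 (lam_r2 u x) (\<alpha>2 v)" for x u v
    using poisson_compat3[of x u v] by (simp add: algebra_simps)
  have compat4: "br2 (lam_r1 x u) (\<alpha>2 v) = lam_r1 (\<alpha>1 x) (br2 u v) + \<alpha>2 u \<bullet> (rho_l1 x v)
      + lam_r1 (rho_r2 v x) (\<alpha>2 u) - rho_l1 (lam_l2 u x) (\<alpha>2 v)" for x u v
    using poisson_compat4[of x u v] by (simp add: algebra_simps)
  have compat5: "rho_r2 (\<alpha>2 u) (x \<cdot> y) = \<alpha>1 x \<cdot> (rho_r2 u y) + lam_r2 (rho_l1 y u) (\<alpha>1 x)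
      + (rho_r2 u x) \<cdot> \<alpha>1 y + lam_l2 (rho_l1 x u) (\<alpha>1 y)" for x y u
    using poisson_compat5[of u x y] by (simp add: algebra_simps)
  have compat6: "rho_r1 (\<alpha>1 x) (u \<bullet> v) = \<alpha>2 u \<bullet> (rho_r1 x v) + lam_r1 (rho_l2 v x) (\<alpha>2 u)
      + (rho_r1 x u) \<bullet> \<alpha>2 v + lam_l1 (rho_l2 u x) (\<alpha>2 v)" for x u v
    using poisson_compat6[of x u v] by (simp add: algebra_simps)
  show ?thesis
    by (cases a; cases b; cases c)
      (simp add: assoc_bilinear leibniz_bilinear R1.hom_poisson R2.hom_poisson
        R1.rho_r_lam_l R2.rho_r_lam_l R1.rho_r_lam_r R2.rho_r_lam_r R1.rho_l_mult R2.rho_l_mult,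
        simp only: compat1 compat2 compat3 compat4 compat5 compat6,
        simp add: algebra_simps)
qed

lemma hom_leibniz_poisson_algebra_sum:
  "hom_leibniz_poisson_algebra (module_prod.scale s1 s2) sum_mult sum_br (map_prod \<alpha>1 \<alpha>2)"
  by (intro hom_leibniz_poisson_algebra.intro hom_leibniz_poisson_algebra_axioms.intro
      hom_associative_algebra_sum hom_leibniz_algebra_sum sum_poisson)

end

theorem proposition4p8:
  fixes s1 :: "'k::field_char_0 \<Rightarrow> 'a::ab_group_add \<Rightarrow> 'a"
    and s2 :: "'k \<Rightarrow> 'b::ab_group_add \<Rightarrow> 'b"
    and mult1 br1 :: "'a \<Rightarrow> 'a \<Rightarrow> 'a" and \<alpha>1 :: "'a \<Rightarrow> 'a"
    and mult2 br2 :: "'b \<Rightarrow> 'b \<Rightarrow> 'b" and \<alpha>2 :: "'b \<Rightarrow> 'b"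
    and lam_l1 lam_r1 rho_l1 rho_r1 :: "'a \<Rightarrow> 'b \<Rightarrow> 'b"
    and lam_l2 lam_r2 rho_l2 rho_r2 :: "'b \<Rightarrow> 'a \<Rightarrow> 'a"
  assumes "hom_leibniz_poisson_algebra s1 mult1 br1 \<alpha>1"
    and "hom_leibniz_poisson_algebra s2 mult2 br2 \<alpha>2"
    and "linear_to_gl s1 s2 lam_l1" and "linear_to_gl s1 s2 lam_r1"
    and "linear_to_gl s1 s2 rho_l1" and "linear_to_gl s1 s2 rho_r1"
    and "linear_to_gl s2 s1 lam_l2" and "linear_to_gl s2 s1 lam_r2"
    and "linear_to_gl s2 s1 rho_l2" and "linear_to_gl s2 s1 rho_r2"
    and "matched_pair_hom_leibniz_poisson s1 mult1 br1 \<alpha>1 lam_l2 lam_r2 rho_l2 rho_r2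
           s2 mult2 br2 \<alpha>2 lam_l1 lam_r1 rho_l1 rho_r1"
  shows "hom_leibniz_poisson_algebra (module_prod.scale s1 s2)
    (\<lambda>(x, u) (y, v). (mult1 x y + lam_l2 u y + lam_r2 v x, mult2 u v + lam_l1 x v + lam_r1 y u))
    (\<lambda>(x, u) (y, v). (br1 x y + rho_l2 u y + rho_r2 v x, br2 u v + rho_l1 x v + rho_r1 y u))
    (\<lambda>(x, u). (\<alpha>1 x, \<alpha>2 u))"
  using matched_pair_hom_leibniz_poisson.hom_leibniz_poisson_algebra_sum[OF assms(11)]
  by (simp add: bicrossed_product_def map_prod_def)

end
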